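(* Let $\mathbf{u}$ and $\mathbf{v}$ be $TB$-sequences in an infinite abelian group $G$. Assume that 1. $\mathcal{T}_{\mathbf{u}}$ and $\mathcal{T}_{\mathbf{v}}$ are locally quasi-convex; 2. $\tau_{\mathbf{u}}=\tau_{\mathbf{v}}$. Then $\mathcal{T}_{\mathbf{u}}=\mathcal{T}_{\mathbf{v}}$.
   Context: All topological groups are Hausdorff and abelian. $\mathbb{T}=\mathbb{R}/\mathbb{Z}$ and $\mathbb{T}_+$ is the image of $[-\frac14,\frac14]$ under the quotient map $\mathbb{R}\to\mathbb{T}$. A group topology on $G$ is precompact if it is Hausdorff and for every neighborhood $U$ of $0$ there is a finite $F\subseteq G$ with $F+U=G$. A sequence $\mathbf{u}=(u_n)$ in an abelian group $G$ is a $TB$-sequence if there is a precompact group topology on $G$ in which $u_n\to0$. For a $TB$-sequence $\mathbf{u}$, $\tau_{\mathbf{u}}$ denotes the finest precompact group topology on $G$ in which $u_n\to 0$, and $\mathcal{T}_{\mathbf{u}}$ denotes the finest Hausdorff group topology on $G$ in which $u_n\to0$. A subset $A$ of a topological abelian group $G$ is quasi-convex if for every $g\in G\setminus A$ there is a continuous character $\chi:G\to\mathbb{T}$ with $\chi(A)\subseteq\mathbb{T}_+$ and $\chi(g)\notin\mathbb{T}_+$. A group topology is locally quasi-convex if it has a base of neighborhoods of $0$ consisting of quasi-convex sets. *)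

theory Defs
  imports "HOL-Analysis.Analysis"
begin

text \<open>The circle group \<open>\<real>/\<int>\<close>, with the quotient group structure and the quotient topology.\<close>

quotient_type circle = real / "\<lambda>x y :: real. x - y \<in> \<int>"
proof (rule equivpI)
  show "reflp (\<lambda>x y :: real. x - y \<in> \<int>)"
    by (simp add: reflp_def)
  show "symp (\<lambda>x y :: real. x - y \<in> \<int>)"
  proof (rule sympI)
    fix x y :: real
    assume "x - y \<in> \<int>"
    then have "- (x - y) \<in> \<int>" by (rule Ints_minus)
    then show "y - x \<in> \<int>" by simp
  qed
  show "transp (\<lambda>x y :: real. x - y \<in> \<int>)"
  proof (rule transpI)
    fix x y z :: real
    assume "x - y \<in> \<int>" "y - z \<in> \<int>"
    then have "(x - y) + (y - z) \<in> \<int>" by (rule Ints_add)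
    then show "x - z \<in> \<int>" by simp
  qed
qed

instantiation circle :: ab_group_add
begin

lift_definition zero_circle :: circle is 0 .

lift_definition plus_circle :: "circle \<Rightarrow> circle \<Rightarrow> circle" is "(+)"
proof -
  fix a b c d :: real
  assume "a - b \<in> \<int>" "c - d \<in> \<int>"
  then have "(a - b) + (c - d) \<in> \<int>" by (rule Ints_add)
  then show "a + c - (b + d) \<in> \<int>" by (simp add: algebra_simps)
qed

lift_definition uminus_circle :: "circle \<Rightarrow> circle" is uminus
proof -
  fix a b :: real
  assume "a - b \<in> \<int>"
  then have "- (a - b) \<in> \<int>" by (rule Ints_minus)
  then show "- a - - b \<in> \<int>" by simp
qed

lift_definition minus_circle :: "circle \<Rightarrow> circle \<Rightarrow> circle" is "(-)"
proof -
  fix a b c d :: real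
  assume "a - b \<in> \<int>" "c - d \<in> \<int>"
  then have "(a - b) - (c - d) \<in> \<int>" by (rule Ints_diff)
  then show "a - c - (b - d) \<in> \<int>" by (simp add: algebra_simps)
qed

instance
proof
  fix a b c :: circle
  show "a + b + c = a + (b + c)" by transfer simp
  show "a + b = b + a" by transfer simp
  show "0 + a = a" by transfer simp
  show "- a + a = 0" by transfer simp
  show "a - b = a + - b" by transfer simp
qed

end

instantiation circle :: topological_space
begin

definition open_circle :: "circle set \<Rightarrow> bool"
  where "open_circle U \<longleftrightarrow> open (abs_circle -` U)"

instance
  by standard (auto simp: open_circle_def vimage_Union)

end

definition circle_plus :: "circle set"
  where "circle_plus = abs_circle ` {-1/4..1/4}"

text \<open>The abelian group is the whole type; topologies on it are values of the type
  \<^typ>\<open>'a topology\<close> with full \<^const>\<open>topspace\<close>. The Hausdorff property is not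
  part of \<open>group_topology\<close> and is always required separately.\<close>

definition group_topology :: "'a::ab_group_add topology \<Rightarrow> bool"
  where "group_topology t \<longleftrightarrow> topspace t = UNIV \<and>
     continuous_map (prod_topology t t) t (\<lambda>(x, y). x + y) \<and>
     continuous_map t t uminus"

definition nhd_zero :: "'a::ab_group_add topology \<Rightarrow> 'a set \<Rightarrow> bool"
  where "nhd_zero t U \<longleftrightarrow> (\<exists>W. openin t W \<and> 0 \<in> W \<and> W \<subseteq> U)"

definition precompact_group_topology :: "'a::ab_group_add topology \<Rightarrow> bool"
  where "precompact_group_topology t \<longleftrightarrow> group_topology t \<and> Hausdorff_space t \<and>
     (\<forall>U. nhd_zero t U \<longrightarrow> (\<exists>F. finite F \<and> {f + x | f x. f \<in> F \<and> x \<in> U} = UNIV))"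

definition continuous_character :: "'a::ab_group_add topology \<Rightarrow> ('a \<Rightarrow> circle) \<Rightarrow> bool"
  where "continuous_character t \<phi> \<longleftrightarrow>
     (\<forall>x y. \<phi> (x + y) = \<phi> x + \<phi> y) \<and> continuous_map t euclidean \<phi>"

definition quasi_convex :: "'a::ab_group_add topology \<Rightarrow> 'a set \<Rightarrow> bool"
  where "quasi_convex t A \<longleftrightarrow>
     (\<forall>g. g \<notin> A \<longrightarrow> (\<exists>\<phi>. continuous_character t \<phi> \<and> \<phi> ` A \<subseteq> circle_plus \<and> \<phi> g \<notin> circle_plus))"

definition locally_quasi_convex :: "'a::ab_group_add topology \<Rightarrow> bool"
  where "locally_quasi_convex t \<longleftrightarrow>
     (\<forall>U. nhd_zero t U \<longrightarrow> (\<exists>V. nhd_zero t V \<and> quasi_convex t V \<and> V \<subseteq> U))"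

definition TB_sequence :: "(nat \<Rightarrow> 'a::ab_group_add) \<Rightarrow> bool"
  where "TB_sequence u \<longleftrightarrow> (\<exists>t. precompact_group_topology t \<and> limitin t u 0 sequentially)"

definition is_finest :: "('a topology \<Rightarrow> bool) \<Rightarrow> 'a topology \<Rightarrow> bool"
  where "is_finest P t \<longleftrightarrow> P t \<and> (\<forall>s. P s \<longrightarrow> (\<forall>U. openin s U \<longrightarrow> openin t U))"

definition finest_precompact :: "(nat \<Rightarrow> 'a::ab_group_add) \<Rightarrow> 'a topology"
  where "finest_precompact u =
     (THE t. is_finest (\<lambda>s. precompact_group_topology s \<and> limitin s u 0 sequentially) t)"

definition finest_Hausdorff :: "(nat \<Rightarrow> 'a::ab_group_add) \<Rightarrow> 'a topology"
  where "finest_Hausdorff u =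
     (THE t. is_finest (\<lambda>s. group_topology s \<and> Hausdorff_space s \<and> limitin s u 0 sequentially) t)"

text \<open>For a \<open>TB\<close>-sequence both descriptions denote: the finest topology exists and is unique.\<close>

lemma is_finest_unique:
  assumes "is_finest P s" "is_finest P t"
  shows "s = t"
  using assms unfolding is_finest_def topology_eq by blast

lemma is_finest_The:
  assumes "is_finest P t"
  shows "is_finest P (THE t. is_finest P t)"
proof -
  have "(THE t. is_finest P t) = t"
    by (rule the_equality[of "is_finest P" t, OF assms]) (rule is_finest_unique[of P _ t, OF _ assms])
  then show ?thesis using assms by simp
qed

definition sup_topology :: "('a topology \<Rightarrow> bool) \<Rightarrow> 'a topology"
  where "sup_topology P = topology_generated_by {U. \<exists>s. P s \<and> openin s U}"

lemma openin_sup_topology: "P s \<Longrightarrow> openin s U \<Longrightarrow> openin (sup_topology P) U"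
  unfolding sup_topology_def by (rule topology_generated_by_Basis) blast

lemma topspace_sup_topology:
  assumes "P s" "topspace s = UNIV"
  shows "topspace (sup_topology P) = UNIV"
  using openin_subset[OF openin_sup_topology[of P, OF assms(1) openin_topspace]] assms(2) by auto

lemma group_topology_sup:
  assumes "P s0" and P: "\<And>s. P s \<Longrightarrow> group_topology s"
  shows "group_topology (sup_topology P)"
proof -
  let ?t = "sup_topology P"
  have top: "topspace ?t = UNIV"
    using topspace_sup_topology[of P, OF assms(1)] P[OF assms(1)] by (simp add: group_topology_def)
  have id: "continuous_map ?t s (\<lambda>x. x)" if "P s" for s
    using P[OF that] top openin_sup_topology[of P, OF that]
    unfolding continuous_map_def group_topology_def by auto
  have into: "continuous_map X ?t f" if "\<And>s. P s \<Longrightarrow> continuous_map X s f" for X :: "'x topology" and f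
    unfolding sup_topology_def
  proof (rule continuous_on_generated_topo)
    show "openin X (f -` U \<inter> topspace X)" if U: "U \<in> {U. \<exists>s. P s \<and> openin s U}" for U
    proof -
      obtain s where s: "P s" "openin s U" using U by blast
      have "openin X {x \<in> topspace X. f x \<in> U}"
        using \<open>\<And>s. P s \<Longrightarrow> continuous_map X s f\<close> s openin_continuous_map_preimage by blast
      moreover have "{x \<in> topspace X. f x \<in> U} = f -` U \<inter> topspace X" by auto
      ultimately show ?thesis by simp
    qed
    have "UNIV \<in> {U. \<exists>s. P s \<and> openin s U}"
      using assms(1) P[OF assms(1)] by (metis (mono_tags) group_topology_def mem_Collect_eq openin_topspace)
    then show "f ` topspace X \<subseteq> \<Union> {U. \<exists>s. P s \<and> openin s U}" by blast
  qed
  have plus: "continuous_map (prod_topology ?t ?t) ?t (\<lambda>(x, y). x + y)"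
  proof (rule into)
    fix s assume s: "P s"
    have "continuous_map (prod_topology ?t ?t) s ((\<lambda>x. x) \<circ> fst)"
      by (rule continuous_map_compose[OF continuous_map_fst id[OF s]])
    moreover have "continuous_map (prod_topology ?t ?t) s ((\<lambda>x. x) \<circ> snd)"
      by (rule continuous_map_compose[OF continuous_map_snd id[OF s]])
    ultimately have "continuous_map (prod_topology ?t ?t) (prod_topology s s) (\<lambda>p. (fst p, snd p))"
      by (intro continuous_map_pairedI) (simp_all add: o_def)
    moreover have "continuous_map (prod_topology s s) s (\<lambda>(x, y). x + y)"
      using P[OF s] by (simp add: group_topology_def)
    ultimately have "continuous_map (prod_topology ?t ?t) s ((\<lambda>(x, y). x + y) \<circ> (\<lambda>p. (fst p, snd p)))"
      by (rule continuous_map_compose)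
    then show "continuous_map (prod_topology ?t ?t) s (\<lambda>(x, y). x + y)"
      by (simp add: o_def case_prod_unfold)
  qed
  have minus: "continuous_map ?t ?t uminus"
  proof (rule into)
    fix s assume s: "P s"
    have "continuous_map ?t s (uminus \<circ> (\<lambda>x. x))"
      using id[OF s] P[OF s] unfolding group_topology_def by (blast intro: continuous_map_compose)
    then show "continuous_map ?t s uminus" by (simp add: o_def)
  qed
  show ?thesis using top plus minus by (simp add: group_topology_def)
qed

lemma Hausdorff_sup:
  fixes s :: "'a topology"
  assumes "P s" "topspace s = UNIV" "Hausdorff_space s"
  shows "Hausdorff_space (sup_topology P)"
  unfolding Hausdorff_space_def
proof (intro allI impI)
  fix x y :: 'a assume "x \<in> topspace (sup_topology P) \<and> y \<in> topspace (sup_topology P) \<and> x \<noteq> y"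
  then have "x \<in> topspace s \<and> y \<in> topspace s \<and> x \<noteq> y" using assms(2) by simp
  then obtain U V where "openin s U" "openin s V" "x \<in> U" "y \<in> V" "disjnt U V"
    using assms(3) unfolding Hausdorff_space_def by blast
  then show "\<exists>U V. openin (sup_topology P) U \<and> openin (sup_topology P) V \<and> x \<in> U \<and> y \<in> V \<and> disjnt U V"
    using openin_sup_topology[of P, OF assms(1)] by blast
qed

lemma limitin_sup:
  assumes "P s0" "topspace s0 = UNIV" and P: "\<And>s. P s \<Longrightarrow> limitin s u l F"
  shows "limitin (sup_topology P) u l F"
proof -
  have "eventually (\<lambda>n. u n \<in> U) F"
    if "generate_topology_on {U. \<exists>s. P s \<and> openin s U} U" "l \<in> U" for U
    using that
  proof (induction)
    case (Int a b)
    then show ?case by (auto intro: eventually_conj)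
  next
    case (UN K)
    then obtain k where "k \<in> K" "l \<in> k" by blast
    then have "eventually (\<lambda>n. u n \<in> k) F" using UN by blast
    then show ?case by (rule eventually_mono) (use \<open>k \<in> K\<close> in blast)
  next
    case (Basis U)
    then show ?case using P unfolding limitin_def by blast
  qed auto
  moreover have "topspace (sup_topology P) = UNIV"
    using topspace_sup_topology[of P, OF assms(1,2)] .
  ultimately show ?thesis
    by (auto simp: limitin_def sup_topology_def openin_topology_generated_by_iff)
qed

lemma precompact_sup:
  assumes "P s0" and P: "\<And>s. P s \<Longrightarrow> precompact_group_topology s"
  shows "precompact_group_topology (sup_topology P)"
proof -
  define Q where "Q V \<longleftrightarrow> (\<exists>C. finite C \<and> \<Union>C = UNIV \<and> (\<forall>c\<in>C. \<forall>x\<in>c. \<forall>y\<in>c. x - y \<in> V))"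
    for V :: "'a set"
  have Q_mono: "Q W" if "Q V" "V \<subseteq> W" for V W
    using that unfolding Q_def by (meson subsetD)
  have Q_Int: "Q (V \<inter> W)" if V: "Q V" and W: "Q W" for V W
  proof -
    obtain C where C: "finite C" "\<Union>C = UNIV" "\<forall>c\<in>C. \<forall>x\<in>c. \<forall>y\<in>c. x - y \<in> V"
      using V Q_def by auto
    obtain D where D: "finite D" "\<Union>D = UNIV" "\<forall>c\<in>D. \<forall>x\<in>c. \<forall>y\<in>c. x - y \<in> W"
      using W Q_def by auto
    define E where "E = (\<lambda>(c, d). c \<inter> d) ` (C \<times> D)"
    have "z \<in> \<Union>E" for z
    proof -
      obtain c d where cd: "c \<in> C" "z \<in> c" "d \<in> D" "z \<in> d" using C(2) D(2) by (metis UNIV_I UnionE)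
      then have "c \<inter> d \<in> E" unfolding E_def by (intro image_eqI[of _ _ "(c, d)"]) auto
      then show ?thesis using cd by blast
    qed
    then have "\<Union>E = UNIV" by auto
    moreover have "finite E" using C(1) D(1) unfolding E_def by simp
    moreover have "\<forall>e\<in>E. \<forall>x\<in>e. \<forall>y\<in>e. x - y \<in> V \<inter> W"
      using C(3) D(3) unfolding E_def by auto
    ultimately show ?thesis unfolding Q_def by blast
  qed
  have Q_basis: "Q {x. x + g \<in> U}" if s: "P s" and U: "openin s U" "g \<in> U" for s U g
  proof -
    have gt: "topspace s = UNIV" "continuous_map (prod_topology s s) s (\<lambda>(x, y). x + y)"
        "continuous_map s s uminus"
      using P[OF s] by (auto simp: precompact_group_topology_def group_topology_def)
    have "continuous_map (prod_topology s s) s (\<lambda>p. fst p + - snd p + g)"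
    proof -
      have plus: "continuous_map X s (\<lambda>p. f p + h p)"
        if "continuous_map X s f" "continuous_map X s h" for X :: "'b topology" and f h
      proof -
        have "continuous_map X s ((\<lambda>(x, y). x + y) \<circ> (\<lambda>p. (f p, h p)))"
          using that gt(2) by (blast intro: continuous_map_compose continuous_map_pairedI)
        then show ?thesis by (simp add: o_def)
      qed
      have "continuous_map (prod_topology s s) s (uminus \<circ> snd)"
        using gt(3) continuous_map_snd continuous_map_compose by blast
      then show ?thesis
        by (intro plus) (auto simp: o_def gt(1) continuous_map_fst)
    qed
    from openin_continuous_map_preimage[OF this U(1)]
    have "openin (prod_topology s s) {p. fst p + - snd p + g \<in> U}" by (simp add: gt(1))
    moreover have "(0, 0) \<in> {p. fst p + - snd p + g \<in> U}" using U by simp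
    ultimately have "\<exists>A B. openin s A \<and> openin s B \<and> 0 \<in> A \<and> 0 \<in> B \<and> A \<times> B \<subseteq> {p. fst p + - snd p + g \<in> U}"
      unfolding openin_prod_topology_alt by (elim allE impE)
    then obtain A B where AB: "openin s A" "openin s B" "0 \<in> A" "0 \<in> B"
        "A \<times> B \<subseteq> {p. fst p + - snd p + g \<in> U}"
      by (elim exE conjE)
    have "nhd_zero s (A \<inter> B)" using AB unfolding nhd_zero_def by blast
    then obtain F where F: "finite F" "{f + x | f x. f \<in> F \<and> x \<in> A \<inter> B} = UNIV"
      using P[OF s] unfolding precompact_group_topology_def by blast
    let ?C = "(\<lambda>f. (+) f ` (A \<inter> B)) ` F"
    have "z \<in> \<Union>?C" for z
    proof -
      have "z \<in> {f + x | f x. f \<in> F \<and> x \<in> A \<inter> B}" using F(2) by simp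
      then show ?thesis by auto
    qed
    then have "\<Union>?C = UNIV" by auto
    moreover have "x - y \<in> {x. x + g \<in> U}" if "c \<in> ?C" "x \<in> c" "y \<in> c" for c x y
    proof -
      obtain f a b where "x = f + a" "y = f + b" "a \<in> A" "b \<in> B" using \<open>c \<in> ?C\<close> \<open>x \<in> c\<close> \<open>y \<in> c\<close> by blast
      then show ?thesis using AB(5) by auto
    qed
    ultimately show ?thesis using F(1) unfolding Q_def by (intro exI[of _ ?C]) auto
  qed
  have Q_open: "Q {x. x + g \<in> U}"
    if "generate_topology_on {U. \<exists>s. P s \<and> openin s U} U" "g \<in> U" for U g
    using that
  proof (induction)
    case (Int a b)
    then have "Q ({x. x + g \<in> a} \<inter> {x. x + g \<in> b})" by (intro Q_Int) auto
    then show ?case by (rule Q_mono) auto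
  next
    case (UN K)
    then obtain k where "k \<in> K" "g \<in> k" by blast
    then have "Q {x. x + g \<in> k}" using UN by blast
    then show ?case by (rule Q_mono) (use \<open>k \<in> K\<close> in blast)
  next
    case (Basis U)
    then show ?case using Q_basis by blast
  qed auto
  have "\<exists>F. finite F \<and> {f + x | f x. f \<in> F \<and> x \<in> U} = UNIV" if U: "nhd_zero (sup_topology P) U" for U
  proof -
    obtain W where W: "openin (sup_topology P) W" "0 \<in> W" "W \<subseteq> U" using U nhd_zero_def by metis
    have "Q W"
      using Q_open[of W 0] W by (simp add: sup_topology_def openin_topology_generated_by_iff)
    then obtain C where C: "finite C" "\<Union>C = UNIV" "\<forall>c\<in>C. \<forall>x\<in>c. \<forall>y\<in>c. x - y \<in> W"
      using Q_def by auto
    let ?F = "(\<lambda>c. SOME x. x \<in> c) ` C"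
    have "z \<in> {f + x | f x. f \<in> ?F \<and> x \<in> U}" for z
    proof -
      have "z \<in> \<Union>C" using C(2) by simp
      then obtain c where c: "c \<in> C" "z \<in> c" by (rule UnionE)
      let ?f = "SOME x. x \<in> c"
      have "?f \<in> c" using c(2) by (rule someI)
      then have "z - ?f \<in> W" using C(3) c by simp
      then have "z - ?f \<in> U" using W(3) by (rule rev_subsetD)
      moreover have "z = ?f + (z - ?f)" by simp
      moreover have "?f \<in> ?F" using c(1) by (rule imageI)
      ultimately show ?thesis by (intro CollectI exI conjI)
    qed
    then have "{f + x | f x. f \<in> ?F \<and> x \<in> U} = UNIV" by (intro UNIV_eq_I[symmetric])
    then show ?thesis using C(1) by (intro exI[of _ ?F] conjI finite_imageI)
  qed
  moreover have "group_topology (sup_topology P)"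
    by (rule group_topology_sup[of P, OF assms(1)]) (use P in \<open>simp add: precompact_group_topology_def\<close>)
  moreover have "Hausdorff_space (sup_topology P)"
    by (rule Hausdorff_sup[of P, OF assms(1)])
      (use P[OF assms(1)] in \<open>simp_all add: precompact_group_topology_def group_topology_def\<close>)
  ultimately show ?thesis unfolding precompact_group_topology_def by blast
qed

lemma is_finest_finest_precompact:
  assumes "TB_sequence u"
  shows "is_finest (\<lambda>s. precompact_group_topology s \<and> limitin s u 0 sequentially) (finest_precompact u)"
proof -
  let ?P = "\<lambda>s. precompact_group_topology s \<and> limitin s u 0 sequentially"
  obtain s where s: "?P s" using assms TB_sequence_def by metis
  have "precompact_group_topology (sup_topology ?P)"
    by (rule precompact_sup[of ?P, OF s]) blast
  moreover have "limitin (sup_topology ?P) u 0 sequentially"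
    by (rule limitin_sup[of ?P, OF s]) (use s in \<open>auto simp: precompact_group_topology_def group_topology_def\<close>)
  ultimately have "is_finest ?P (sup_topology ?P)"
    unfolding is_finest_def using openin_sup_topology[of ?P] by blast
  then show ?thesis
    unfolding finest_precompact_def by (rule is_finest_The[of ?P "sup_topology ?P"])
qed

lemma is_finest_finest_Hausdorff:
  assumes "TB_sequence u"
  shows "is_finest (\<lambda>s. group_topology s \<and> Hausdorff_space s \<and> limitin s u 0 sequentially) (finest_Hausdorff u)"
proof -
  let ?P = "\<lambda>s. group_topology s \<and> Hausdorff_space s \<and> limitin s u 0 sequentially"
  obtain s where s: "?P s" using assms TB_sequence_def precompact_group_topology_def by metis
  have top: "topspace s = UNIV" using s group_topology_def by metis
  have "group_topology (sup_topology ?P)"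
    by (rule group_topology_sup[of ?P, OF s]) blast
  moreover have "Hausdorff_space (sup_topology ?P)"
    by (rule Hausdorff_sup[of ?P, OF s top]) (use s in blast)
  moreover have "limitin (sup_topology ?P) u 0 sequentially"
    by (rule limitin_sup[of ?P, OF s top]) blast
  ultimately have "is_finest ?P (sup_topology ?P)"
    unfolding is_finest_def using openin_sup_topology[of ?P] by blast
  then show ?thesis
    unfolding finest_Hausdorff_def by (rule is_finest_The[of ?P "sup_topology ?P"])
qed

end

theory Submission
  imports Defs
begin

text \<open>
  By symmetry it suffices that \<open>v\<close> converges to \<open>0\<close> in \<open>finest_Hausdorff u\<close>: this topology is then
  one of those among which \<open>finest_Hausdorff v\<close> is the finest.

  The topology \<open>finest_precompact u\<close> determines the set of characters \<open>\<xi>\<close> of the abstract group with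
  \<open>\<xi> (u n) \<longlonglongrightarrow> 0\<close>: they are exactly its continuous characters
  (\<open>continuous_map_finest_precompact_iff\<close>), because adding such a character to a precompact
  topology keeps it precompact and keeps \<open>u\<close> null. Equality of the two precompact topologies
  therefore says that a character is null along \<open>u\<close> if and only if it is null along \<open>v\<close>.

  Let \<open>V\<close> be a quasi-convex neighbourhood of \<open>0\<close> in \<open>finest_Hausdorff u\<close>, and let \<open>S\<close> be the set of
  all characters that map \<open>V\<close> into \<^const>\<open>circle_plus\<close>. As \<open>S\<close> is equicontinuous, it tends to \<open>0\<close> along
  \<open>u\<close> uniformly (\<open>uniform_limit_polar\<close>). The heart of the matter is that pointwise transfer from \<open>u\<close> to
  \<open>v\<close> forces uniform transfer (\<open>uniform_limit_null_transfer\<close>): \<open>S\<close> tends to \<open>0\<close> uniformly along \<open>v\<close>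
  too. Hence, for large \<open>n\<close>, every character in \<open>S\<close> maps \<open>v n\<close> into \<^const>\<open>circle_plus\<close>, and
  quasi-convexity puts \<open>v n\<close> into \<open>V\<close>.

  Uniform transfer is an automatic continuity statement, proved by a sliding hump. If it
  failed, subtracting a cluster point from suitable members of \<open>S\<close> would give characters that are uniformly tiny along \<open>u\<close> but
  have one large value each along \<open>v\<close>, at places going to infinity. A sparse subsequence has a
  sum that is null along \<open>u\<close> and not null along \<open>v\<close>. Compactness of the group of all
  characters in the topology of pointwise convergence supplies the limits: a cluster point of the
  partial sums serves as the sum, so no convergence on the whole group has to be arranged.
\<close>

section \<open>The invariant metric of the circle\<close>

text \<open>
  The distance of a representative from the nearest integer. Its triangle inequality and its
  symmetry come from the minimality of that integer.
\<close>

lift_definition circle_norm :: "circle \<Rightarrow> real" is "\<lambda>x. \<bar>x - of_int (round x)\<bar>"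
proof -
  fix x y :: real
  assume "x - y \<in> \<int>"
  then obtain k where k: "x = y + of_int k" by (metis Ints_cases diff_add_cancel add.commute)
  show "\<bar>x - of_int (round x)\<bar> = \<bar>y - of_int (round y)\<bar>"
    using round_diff_minimal[of x "round y + k"] round_diff_minimal[of y "round x - k"] k
    by simp
qed

lemma circle_norm_triangle: "circle_norm (x + y) \<le> circle_norm x + circle_norm y"
proof (transfer)
  fix x y :: real
  show "\<bar>x + y - of_int (round (x + y))\<bar> \<le> \<bar>x - of_int (round x)\<bar> + \<bar>y - of_int (round y)\<bar>"
    using round_diff_minimal[of "x + y" "round x + round y"] by simp
qed

lemma circle_norm_minus [simp]: "circle_norm (- x) = circle_norm x"
proof (transfer)
  fix x :: real
  show "\<bar>- x - of_int (round (- x))\<bar> = \<bar>x - of_int (round x)\<bar>"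
    using round_diff_minimal[of "- x" "- round x"] round_diff_minimal[of x "- round (- x)"] by simp
qed

lemma circle_norm_0 [simp]: "circle_norm 0 = 0"
  by transfer simp

lemma circle_norm_nonneg [simp]: "0 \<le> circle_norm x"
  by transfer simp

lemma circle_norm_eq_0_iff [simp]: "circle_norm x = 0 \<longleftrightarrow> x = 0"
proof transfer
  fix x :: real
  show "\<bar>x - of_int (round x)\<bar> = 0 \<longleftrightarrow> x - 0 \<in> \<int>"
    by (auto elim!: Ints_cases simp: Ints_def)
qed

lemma circle_norm_diff: "circle_norm (x - y) \<le> circle_norm x + circle_norm y"
  using circle_norm_triangle[of x "- y"] by simp

lemma circle_norm_le_add_diff: "circle_norm x \<le> circle_norm y + circle_norm (x - y)"
  using circle_norm_triangle[of y "x - y"] by simp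

lemma circle_norm_sum: "circle_norm (sum f A) \<le> (\<Sum>i\<in>A. circle_norm (f i))"
proof (induction A rule: infinite_finite_induct)
  case (insert a A)
  then show ?case using circle_norm_triangle[of "f a" "sum f A"] by simp
qed auto

lemma circle_norm_abs_circle_le: "circle_norm (abs_circle r) \<le> \<bar>r\<bar>"
  using round_diff_minimal[of r 0] by (simp add: circle_norm.abs_eq)

lemma circle_rep_minimal: obtains r where "x = abs_circle r" "\<bar>r\<bar> = circle_norm x"
proof -
  obtain s where s: "x = abs_circle s" by (metis Quotient_circle Quotient_abs_rep)
  have "abs_circle (s - of_int (round s)) = x"
    unfolding s by (simp add: circle.abs_eq_iff)
  moreover have "\<bar>s - of_int (round s)\<bar> = circle_norm x"
    unfolding s by (simp add: circle_norm.abs_eq)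
  ultimately show ?thesis using that by metis
qed

lemma circle_plus_iff: "x \<in> circle_plus \<longleftrightarrow> circle_norm x \<le> 1/4"
proof
  assume "x \<in> circle_plus"
  then obtain r where "x = abs_circle r" "\<bar>r\<bar> \<le> 1/4" unfolding circle_plus_def by auto
  then show "circle_norm x \<le> 1/4" using circle_norm_abs_circle_le[of r] by simp
next
  assume *: "circle_norm x \<le> 1/4"
  obtain r where "x = abs_circle r" "\<bar>r\<bar> = circle_norm x" by (rule circle_rep_minimal)
  then show "x \<in> circle_plus" using * unfolding circle_plus_def by (auto intro!: imageI)
qed

text \<open>
  In this range doubling does not wrap around the circle. A bound at \<open>x + x\<close> is therefore halved at
  \<open>x\<close>, which makes the polar of a neighbourhood equicontinuous.
\<close>

lemma circle_norm_double:
  assumes "circle_norm x \<le> 1/4"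
  shows "circle_norm (x + x) = 2 * circle_norm x"
proof -
  obtain r where r: "x = abs_circle r" "\<bar>r\<bar> = circle_norm x" by (rule circle_rep_minimal)
  have "\<bar>2 * r\<bar> \<le> \<bar>2 * r - of_int k\<bar>" for k :: int
  proof (cases "k = 0")
    case False
    then have "1 \<le> \<bar>real_of_int k\<bar>" by linarith
    then show ?thesis using assms r(2) by linarith
  qed simp
  moreover have "\<bar>2 * r - of_int (round (2 * r))\<bar> \<le> \<bar>2 * r\<bar>"
    using round_diff_minimal[of "2 * r" 0] by simp
  ultimately have "\<bar>2 * r - of_int (round (2 * r))\<bar> = \<bar>2 * r\<bar>"
    by (intro antisym) auto
  moreover have "x + x = abs_circle (2 * r)"
    by (simp add: r(1) plus_circle.abs_eq)
  ultimately show ?thesis using r(2) by (simp add: circle_norm.abs_eq)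
qed

text \<open>
  The quotient topology is induced by this norm, so that compactness, limits and
  uniform limits of characters are available from the theory of metric spaces.
\<close>

instantiation circle :: metric_space
begin

definition dist_circle :: "circle \<Rightarrow> circle \<Rightarrow> real"
  where "dist_circle x y = circle_norm (x - y)"

definition uniformity_circle :: "(circle \<times> circle) filter"
  where "uniformity_circle = (INF e\<in>{0 <..}. principal {(x, y). dist x y < e})"

instance
proof
  fix x y z :: circle
  show "uniformity = (INF e\<in>{0 <..}. principal {(x, y :: circle). dist x y < e})"
    by (rule uniformity_circle_def)
  show "dist x y = 0 \<longleftrightarrow> x = y" by (simp add: dist_circle_def)
  show "dist x y \<le> dist x z + dist y z"
    using circle_norm_diff[of "x - z" "y - z"] by (simp add: dist_circle_def)
next
  fix U :: "circle set"
  have ev_uniformity: "eventually P uniformity \<longleftrightarrow> (\<exists>e>0. \<forall>x y :: circle. dist x y < e \<longrightarrow> P (x, y))" for P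
    unfolding uniformity_circle_def
    by (subst eventually_INF_base)
      (auto simp: eventually_principal subset_eq intro: bexI[of _ "min _ _"])
  have sym: "circle_norm (x - y) = circle_norm (y - x)" for x y :: circle
    by (metis circle_norm_minus minus_diff_eq)
  have "open U \<longleftrightarrow> (\<forall>x\<in>U. \<exists>e>0. \<forall>y. circle_norm (x - y) < e \<longrightarrow> y \<in> U)"
  proof
    assume U: "open U"
    show "\<forall>x\<in>U. \<exists>e>0. \<forall>y. circle_norm (x - y) < e \<longrightarrow> y \<in> U"
    proof
      fix x assume x: "x \<in> U"
      obtain r where r: "x = abs_circle r" by (metis circle_rep_minimal)
      have "open (abs_circle -` U)" using U by (simp add: open_circle_def)
      then obtain e where e: "e > 0" "\<And>s. \<bar>s - r\<bar> < e \<Longrightarrow> abs_circle s \<in> U"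
        using x r by (force simp: open_dist dist_real_def)
      have "y \<in> U" if "circle_norm (x - y) < e" for y
      proof -
        obtain t where t: "y - x = abs_circle t" "\<bar>t\<bar> = circle_norm (y - x)"
          by (rule circle_rep_minimal)
        have "abs_circle (r + t) = abs_circle r + abs_circle t" by (simp add: plus_circle.abs_eq)
        also have "\<dots> = y" by (simp flip: r t(1))
        finally show ?thesis using e(2)[of "r + t"] t(2) that sym by simp
      qed
      then show "\<exists>e>0. \<forall>y. circle_norm (x - y) < e \<longrightarrow> y \<in> U" using e(1) by blast
    qed
  next
    assume *: "\<forall>x\<in>U. \<exists>e>0. \<forall>y. circle_norm (x - y) < e \<longrightarrow> y \<in> U"
    have "\<exists>e>0. \<forall>s. dist s r < e \<longrightarrow> s \<in> abs_circle -` U" if "r \<in> abs_circle -` U" for r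
    proof -
      obtain e where e: "e > 0" "\<And>y. circle_norm (abs_circle r - y) < e \<Longrightarrow> y \<in> U"
        using * \<open>r \<in> abs_circle -` U\<close> by (metis vimageD)
      have "circle_norm (abs_circle r - abs_circle s) \<le> dist s r" for s
        using circle_norm_abs_circle_le[of "r - s"]
        by (simp add: minus_circle.abs_eq dist_real_def abs_minus_commute)
      then show ?thesis using e by (intro exI[of _ e]) (force intro: le_less_trans)
    qed
    then show "open U" unfolding open_circle_def open_dist by blast
  qed
  then show "open U \<longleftrightarrow> (\<forall>x\<in>U. \<forall>\<^sub>F (x', y) in uniformity. x' = x \<longrightarrow> y \<in> U)"
    unfolding ev_uniformity dist_circle_def by fast
qed

end

lemma dist_circle_0 [simp]: "dist x (0::circle) = circle_norm x"
  by (simp add: dist_circle_def)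

lemma dist_abs_circle_le: "dist (abs_circle r) (abs_circle s) \<le> dist r s"
  using circle_norm_abs_circle_le[of "r - s"]
  by (simp add: dist_circle_def dist_real_def minus_circle.abs_eq)

lemma compact_UNIV_circle: "compact (UNIV :: circle set)"
proof -
  have "continuous_on {0..1} abs_circle"
    by (rule continuous_on_subset[of UNIV])
      (auto simp: continuous_on_iff intro!: exI intro: le_less_trans[OF dist_abs_circle_le])
  moreover have "abs_circle ` {0..1} = UNIV"
  proof (intro UNIV_eq_I[symmetric])
    fix x
    obtain r where r: "x = abs_circle r" by (metis circle_rep_minimal)
    have "x = abs_circle (frac r)"
      unfolding r frac_def by (simp add: circle.abs_eq_iff)
    then show "x \<in> abs_circle ` {0..1}"
      using frac_ge_0[of r] frac_lt_1[of r] by (auto intro!: imageI)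
  qed
  ultimately show ?thesis
    by (metis compact_Icc compact_continuous_image)
qed

instance circle :: topological_ab_group_add
proof
  fix a b :: circle
  show "((\<lambda>p. fst p + snd p) \<longlongrightarrow> a + b) (nhds a \<times>\<^sub>F nhds b)"
  proof (rule metric_tendsto_imp_tendsto[of "\<lambda>p. dist (fst p) a + dist (snd p) b" 0])
    have "((\<lambda>p. fst p) \<longlongrightarrow> a) (nhds a \<times>\<^sub>F nhds b)" "((\<lambda>p. snd p) \<longlongrightarrow> b) (nhds a \<times>\<^sub>F nhds b)"
      by (auto intro: filterlim_fst filterlim_snd)
    then have "((\<lambda>p. dist (fst p) a + dist (snd p) b) \<longlongrightarrow> dist a a + dist b b) (nhds a \<times>\<^sub>F nhds b)"
      by (intro tendsto_intros)
    then show "((\<lambda>p. dist (fst p) a + dist (snd p) b) \<longlongrightarrow> 0) (nhds a \<times>\<^sub>F nhds b)" by simp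
    show "\<forall>\<^sub>F p in nhds a \<times>\<^sub>F nhds b.
        dist (fst p + snd p) (a + b) \<le> dist (dist (fst p) a + dist (snd p) b) 0"
    proof (intro always_eventually allI)
      fix p :: "circle \<times> circle"
      show "dist (fst p + snd p) (a + b) \<le> dist (dist (fst p) a + dist (snd p) b) 0"
        using circle_norm_triangle[of "fst p - a" "snd p - b"]
        by (simp add: dist_circle_def algebra_simps)
    qed
  qed
  have "dist (- x) (- a) = dist x a" for x :: circle
    using circle_norm_minus[of "x - a"] by (simp add: dist_circle_def del: circle_norm_minus)
  then show "(uminus \<longlongrightarrow> - a) (nhds a)"
    by (auto simp: tendsto_iff eventually_nhds_metric)
qed


section \<open>Characters\<close>

lemma frequently_if_inf_ne_bot:
  assumes "inf F G \<noteq> bot" "eventually P F"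
  shows "frequently P G"
proof (rule ccontr)
  assume "\<not> frequently P G"
  then have "eventually (\<lambda>x. \<not> P x) G" by (simp add: not_frequently)
  then have "eventually (\<lambda>x. False) (inf F G)"
    unfolding eventually_inf using assms(2) by (intro exI[of _ P] exI[of _ "\<lambda>x. \<not> P x"]) auto
  then show False using assms(1) by (simp add: trivial_limit_def)
qed

text \<open>
  The group of all characters is compact for pointwise convergence, by Tychonoff's theorem. For
  an uncountable group it need not be sequentially compact, so one gets a cluster point and no
  convergent subsequence; closeness infinitely often on each finite set is enough below.
\<close>

lemma additive_cluster_point:
  fixes f :: "nat \<Rightarrow> 'a::ab_group_add \<Rightarrow> circle"
  assumes "\<And>n. Modules.additive (f n)"
  obtains \<phi> where "Modules.additive \<phi>"
    and "\<And>F e. finite F \<Longrightarrow> 0 < e \<Longrightarrow> \<exists>\<^sub>F n in sequentially. \<forall>x\<in>F. dist (f n x) (\<phi> x) < e"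
proof -
  have "compact_space (euclidean :: circle topology)"
    using compact_UNIV_circle by (simp add: compact_space_def)
  then have "compact_space (product_topology (\<lambda>_::'a. euclidean :: circle topology) UNIV)"
    by (simp add: compact_space_product_topology)
  then have "compact (UNIV :: ('a \<Rightarrow> circle) set)"
    by (simp add: euclidean_product_topology compact_space_def)
  moreover have "filtermap f sequentially \<noteq> bot" by (simp add: filtermap_bot_iff)
  ultimately obtain \<phi> where \<phi>: "inf (nhds \<phi>) (filtermap f sequentially) \<noteq> bot"
    unfolding compact_filter by (elim allE[of _ "filtermap f sequentially"]) auto
  have close: "\<exists>\<^sub>F n in sequentially. \<forall>x\<in>F. dist (f n x) (\<phi> x) < e"
    if "finite F" "0 < e" for F and e :: real
  proof -
    have "((\<lambda>g. g x) \<longlongrightarrow> \<phi> x) (nhds \<phi>)" for x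
    proof -
      have "continuous_on UNIV (\<lambda>g :: 'a \<Rightarrow> circle. g x)"
        by (rule continuous_on_product_coordinates)
      then have "((\<lambda>g. g x) \<longlongrightarrow> \<phi> x) (at \<phi>)"
        by (simp add: continuous_on_def)
      then show ?thesis by (rule tendsto_at_iff_tendsto_nhds[of "\<lambda>g. g x" \<phi>, THEN iffD1])
    qed
    then have "eventually (\<lambda>g. dist (g x) (\<phi> x) < e) (nhds \<phi>)" for x
      using \<open>0 < e\<close> by (simp add: tendsto_iff)
    then have "eventually (\<lambda>g. \<forall>x\<in>F. dist (g x) (\<phi> x) < e) (nhds \<phi>)"
      using \<open>finite F\<close> by (simp add: eventually_ball_finite_distrib)
    from frequently_if_inf_ne_bot[OF \<phi> this] show ?thesis
      by (simp add: frequently_filtermap)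
  qed
  have "\<phi> (x + y) = \<phi> x + \<phi> y" for x y
  proof -
    have "dist (\<phi> (x + y)) (\<phi> x + \<phi> y) \<le> e" if "0 < e" for e :: real
    proof -
      obtain n where n: "dist (f n z) (\<phi> z) < e / 3" if "z \<in> {x, y, x + y}" for z
        using frequently_ex[OF close[of "{x, y, x + y}" "e / 3"]] \<open>0 < e\<close> by auto
      have eq: "\<phi> (x + y) - (\<phi> x + \<phi> y)
          = ((f n x - \<phi> x) + (f n y - \<phi> y)) - (f n (x + y) - \<phi> (x + y))"
        using Modules.additive.add[OF assms, of n x y] by (simp add: algebra_simps)
      show ?thesis
        using circle_norm_diff[of "(f n x - \<phi> x) + (f n y - \<phi> y)" "f n (x + y) - \<phi> (x + y)"]
          circle_norm_triangle[of "f n x - \<phi> x" "f n y - \<phi> y"] n[of x] n[of y] n[of "x + y"]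
        unfolding dist_circle_def eq by (simp del: add_diff_eq diff_add_eq diff_diff_eq2)
    qed
    then have "dist (\<phi> (x + y)) (\<phi> x + \<phi> y) \<le> 0" by (rule field_le_epsilon) simp
    then show ?thesis by simp
  qed
  then have "Modules.additive \<phi>" by (rule Modules.additive.intro)
  then show thesis using close that by blast
qed

text \<open>
  The sliding hump. A failure of uniformity along \<open>v\<close> is witnessed by \<open>\<phi> k\<close> in \<open>S\<close> with
  \<open>\<phi> k (v (p k))\<close> large. After subtracting a cluster point \<open>\<phi>0\<close>, the characters
  \<open>\<psi> k = \<phi> k - \<phi>0\<close> are frequently small at any finitely many points, and even on the whole range
  of \<open>u\<close>, since \<open>S\<close> controls all but finitely many \<open>u n\<close>. Choosing indices \<open>\<kappa> j\<close> one after the other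
  makes the matrix \<open>\<psi> (\<kappa> i) (v (p (\<kappa> j)))\<close> large on the diagonal and summably small off it, so that
  \<open>\<xi> = (\<Sum>i. \<psi> (\<kappa> i))\<close> contradicts the pointwise hypothesis.
\<close>

lemma uniform_limit_null_transfer:
  fixes u v :: "nat \<Rightarrow> 'a::ab_group_add" and S :: "('a \<Rightarrow> circle) set"
  assumes null: "\<And>\<xi> :: 'a \<Rightarrow> circle. Modules.additive \<xi> \<Longrightarrow> (\<lambda>n. \<xi> (u n)) \<longlonglongrightarrow> 0 \<Longrightarrow> (\<lambda>n. \<xi> (v n)) \<longlonglongrightarrow> 0"
    and S: "\<And>\<phi>. \<phi> \<in> S \<Longrightarrow> Modules.additive \<phi>"
    and lim: "uniform_limit S (\<lambda>n \<phi>. \<phi> (u n)) (\<lambda>_. 0) sequentially"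
  shows "uniform_limit S (\<lambda>n \<phi>. \<phi> (v n)) (\<lambda>_. 0) sequentially"
proof (rule ccontr)
  assume "\<not> ?thesis"
  then obtain e where e: "e > 0" and "\<forall>N. \<exists>n\<ge>N. \<exists>\<phi>\<in>S. e \<le> circle_norm (\<phi> (v n))"
    by (auto simp: uniform_limit_sequentially_iff not_less)
  then obtain p \<phi> where p: "\<And>k. p k \<ge> k" and \<phi>: "\<And>k. \<phi> k \<in> S"
      and big: "\<And>k. e \<le> circle_norm (\<phi> k (v (p k)))"
    by metis
  have lim': "\<exists>N. \<forall>n\<ge>N. \<forall>k. circle_norm (\<phi> k (u n)) < d" if "d > 0" for d
    using lim that \<phi> by (force simp: uniform_limit_sequentially_iff)
  obtain \<phi>0 where \<phi>0: "Modules.additive \<phi>0"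
    and close0: "\<And>F d. finite F \<Longrightarrow> 0 < d \<Longrightarrow> \<exists>\<^sub>F k in sequentially. \<forall>x\<in>F. dist (\<phi> k x) (\<phi>0 x) < d"
    using additive_cluster_point[of \<phi>] S \<phi> by blast
  have \<phi>0_le: "circle_norm (\<phi>0 x) \<le> 2 * d" if "\<And>k. circle_norm (\<phi> k x) < d" for x d
  proof -
    have "d > 0" using that le_less_trans[OF circle_norm_nonneg] by blast
    then obtain k where "dist (\<phi> k x) (\<phi>0 x) < d"
      using frequently_ex[OF close0[of "{x}" d]] by auto
    then have "circle_norm (\<phi>0 x - \<phi> k x) < d"
      by (simp add: dist_commute flip: dist_circle_def)
    then show ?thesis
      using circle_norm_le_add_diff[of "\<phi>0 x" "\<phi> k x"] that[of k] by simp
  qed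
  \<comment> \<open>The cluster point need not lie in \<open>S\<close>, but it inherits the uniform bounds along \<open>u\<close>.\<close>
  have "(\<lambda>n. \<phi>0 (u n)) \<longlonglongrightarrow> 0"
    unfolding lim_sequentially dist_circle_0
  proof (intro allI impI)
    fix d :: real assume "d > 0"
    then obtain N where "\<forall>n\<ge>N. \<forall>k. circle_norm (\<phi> k (u n)) < d / 3" using lim'[of "d / 3"] by auto
    then have "\<forall>n\<ge>N. circle_norm (\<phi>0 (u n)) < d" using \<phi>0_le[of "u _" "d / 3"] \<open>d > 0\<close> by force
    then show "\<exists>N. \<forall>n\<ge>N. circle_norm (\<phi>0 (u n)) < d" by blast
  qed
  with null \<phi>0 have \<phi>0_v: "(\<lambda>n. \<phi>0 (v n)) \<longlonglongrightarrow> 0" by blast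
  define \<psi> where "\<psi> k x = \<phi> k x - \<phi>0 x" for k x
  have \<psi>_add: "Modules.additive (\<psi> k)" for k
    using S[OF \<phi>, of k] \<phi>0 by (simp add: Modules.additive_def \<psi>_def)
  have \<psi>_u: "(\<lambda>n. \<psi> k (u n)) \<longlonglongrightarrow> 0" for k
  proof -
    have "(\<lambda>n. \<phi> k (u n)) \<longlonglongrightarrow> 0"
      unfolding lim_sequentially dist_circle_0 using lim' by blast
    from tendsto_diff[OF this \<open>(\<lambda>n. \<phi>0 (u n)) \<longlonglongrightarrow> 0\<close>] show ?thesis by (simp add: \<psi>_def)
  qed
  then have \<psi>_v: "(\<lambda>n. \<psi> k (v n)) \<longlonglongrightarrow> 0" for k using null \<psi>_add by blast
  \<comment> \<open>Closeness at the points \<open>u n\<close> with \<open>n < N\<close> is a condition at finitely many points; the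
    remaining ones are handled by the uniform bounds.\<close>
  have \<psi>_close: "\<exists>\<^sub>F k in sequentially. (\<forall>n. circle_norm (\<psi> k (u n)) \<le> d) \<and> (\<forall>x\<in>F. circle_norm (\<psi> k x) \<le> d)"
    if d: "d > 0" and F: "finite F" for d F
  proof -
    obtain N where N: "\<And>n k. n \<ge> N \<Longrightarrow> circle_norm (\<phi> k (u n)) < d / 3"
      using lim'[of "d / 3"] d by auto
    have tail: "circle_norm (\<psi> k (u n)) \<le> d" if "n \<ge> N" for k n
      using N[OF that, of k] \<phi>0_le[OF N[OF that]] circle_norm_diff[of "\<phi> k (u n)" "\<phi>0 (u n)"]
      by (simp add: \<psi>_def)
    have "\<exists>\<^sub>F k in sequentially. \<forall>x\<in>F \<union> u ` {..<N}. dist (\<phi> k x) (\<phi>0 x) < d"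
      using close0 d F by simp
    then show ?thesis
    proof (rule frequently_elim1)
      fix k assume *: "\<forall>x\<in>F \<union> u ` {..<N}. dist (\<phi> k x) (\<phi>0 x) < d"
      have "circle_norm (\<psi> k (u n)) \<le> d" for n
        using tail[of n k] * by (cases "n < N") (auto simp: dist_circle_def \<psi>_def less_imp_le)
      then show "(\<forall>n. circle_norm (\<psi> k (u n)) \<le> d) \<and> (\<forall>x\<in>F. circle_norm (\<psi> k x) \<le> d)"
        using * by (auto simp: dist_circle_def \<psi>_def less_imp_le)
    qed
  qed
  have p_lim: "filterlim p at_top sequentially"
    using p by (intro filterlim_at_top_mono[OF filterlim_ident]) auto
  define \<delta> where "\<delta> i = e / 16 * (1/2) ^ i" for i :: nat
  have \<delta>_pos: "\<delta> i > 0" for i using e by (simp add: \<delta>_def)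
  have \<delta>_antimono: "\<delta> j \<le> \<delta> i" if "i \<le> j" for i j
    using e that by (simp add: \<delta>_def power_decreasing)
  have \<delta>_sum: "(\<Sum>i\<in>{I..<J}. \<delta> i) \<le> 2 * \<delta> I" for I J
  proof (cases "I \<le> J")
    case True
    have "(\<Sum>i\<in>{I..<J}. \<delta> i) = 2 * (\<delta> I - \<delta> J)"
      using True by (induction rule: dec_induct) (auto simp: \<delta>_def)
    then show ?thesis using \<delta>_pos[of J] by simp
  qed (use \<delta>_pos[of I] in simp)
  \<comment> \<open>Entries below the diagonal are small by closeness to \<open>\<phi>0\<close> at the finitely many earlier points,
    entries above it because the finitely many earlier characters are null along \<open>v\<close>.\<close>
  have "\<exists>\<kappa> :: nat \<Rightarrow> nat. \<forall>j. \<kappa> j \<ge> j \<and> (\<forall>n. circle_norm (\<psi> (\<kappa> j) (u n)) \<le> \<delta> j)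
      \<and> (\<forall>i<j. circle_norm (\<psi> (\<kappa> j) (v (p (\<kappa> i)))) \<le> \<delta> j)
      \<and> (\<forall>i<j. circle_norm (\<psi> (\<kappa> i) (v (p (\<kappa> j)))) < \<delta> j)
      \<and> circle_norm (\<phi>0 (v (p (\<kappa> j)))) < e / 2"
  proof (rule dependent_wellorder_choice)
    fix j :: nat and \<kappa> :: "nat \<Rightarrow> nat"
    have "\<forall>\<^sub>F k in sequentially. circle_norm (\<psi> (\<kappa> i) (v (p k))) < \<delta> j" for i
      using filterlim_compose[OF \<psi>_v p_lim] \<delta>_pos by (simp add: tendsto_iff)
    then have "\<forall>\<^sub>F k in sequentially. \<forall>i\<in>{..<j}. circle_norm (\<psi> (\<kappa> i) (v (p k))) < \<delta> j"
      by (simp add: eventually_ball_finite_distrib)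
    moreover have "\<forall>\<^sub>F k in sequentially. circle_norm (\<phi>0 (v (p k))) < e / 2"
      using tendstoD[OF filterlim_compose[OF \<phi>0_v p_lim], of "e / 2"] e by simp
    moreover have "\<forall>\<^sub>F k in sequentially. k \<ge> j" by (rule eventually_ge_at_top)
    ultimately have "\<forall>\<^sub>F k in sequentially. k \<ge> j \<and> circle_norm (\<phi>0 (v (p k))) < e / 2
        \<and> (\<forall>i<j. circle_norm (\<psi> (\<kappa> i) (v (p k))) < \<delta> j)"
      by eventually_elim auto
    from frequently_eventually_conj[OF \<psi>_close[OF \<delta>_pos, of "(\<lambda>i. v (p (\<kappa> i))) ` {..<j}" j] this]
    show "\<exists>k. k \<ge> j \<and> (\<forall>n. circle_norm (\<psi> k (u n)) \<le> \<delta> j)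
      \<and> (\<forall>i<j. circle_norm (\<psi> k (v (p (\<kappa> i)))) \<le> \<delta> j)
      \<and> (\<forall>i<j. circle_norm (\<psi> (\<kappa> i) (v (p k))) < \<delta> j)
      \<and> circle_norm (\<phi>0 (v (p k))) < e / 2"
      by (auto dest!: frequently_ex)
  qed auto
  then obtain \<kappa> :: "nat \<Rightarrow> nat" where \<kappa>_ge: "\<And>j. \<kappa> j \<ge> j"
    and \<kappa>_u: "\<And>j n. circle_norm (\<psi> (\<kappa> j) (u n)) \<le> \<delta> j"
    and \<kappa>_gt: "\<And>i j. i < j \<Longrightarrow> circle_norm (\<psi> (\<kappa> j) (v (p (\<kappa> i)))) \<le> \<delta> j"
    and \<kappa>_lt: "\<And>i j. i < j \<Longrightarrow> circle_norm (\<psi> (\<kappa> i) (v (p (\<kappa> j)))) < \<delta> j"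
    and \<kappa>_\<phi>0: "\<And>j. circle_norm (\<phi>0 (v (p (\<kappa> j)))) < e / 2"
    by metis
  have off_diag: "circle_norm (\<psi> (\<kappa> i) (v (p (\<kappa> j)))) \<le> \<delta> i" if "i \<noteq> j" for i j
    using \<kappa>_gt[of j i] \<kappa>_lt[of i j] \<delta>_antimono[of i j] that by (cases "i < j") auto
  have diag: "circle_norm (\<psi> (\<kappa> j) (v (p (\<kappa> j)))) \<ge> e / 2" for j
    using circle_norm_le_add_diff[of "\<phi> (\<kappa> j) (v (p (\<kappa> j)))" "\<phi>0 (v (p (\<kappa> j)))"]
      big[of "\<kappa> j"] \<kappa>_\<phi>0[of j] by (simp add: \<psi>_def)
  \<comment> \<open>The partial sums need not converge at every point of the group; a cluster point replaces the
    limit.\<close>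
  define s where "s J x = (\<Sum>i<J. \<psi> (\<kappa> i) x)" for J x
  have "Modules.additive (s J)" for J
    using \<psi>_add by (simp add: Modules.additive_def s_def sum.distrib)
  then obtain \<xi> where \<xi>: "Modules.additive \<xi>"
    and close: "\<And>F d. finite F \<Longrightarrow> 0 < d \<Longrightarrow> \<exists>\<^sub>F J in sequentially. \<forall>x\<in>F. dist (s J x) (\<xi> x) < d"
    using additive_cluster_point[of s] by blast
  have near: "\<exists>J\<ge>I. circle_norm (s J x - \<xi> x) < d" if "d > 0" for x I d
    using frequently_ex[OF frequently_eventually_conj[OF close[of "{x}" d] eventually_ge_at_top[of I]]] that
    by (auto simp: dist_circle_def)
  have "(\<lambda>n. \<xi> (u n)) \<longlonglongrightarrow> 0"
    unfolding lim_sequentially dist_circle_0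
  proof (intro allI impI)
    fix d :: real assume d: "d > 0"
    have "\<delta> \<longlonglongrightarrow> 0" unfolding \<delta>_def by (intro tendsto_mult_right_zero LIMSEQ_realpow_zero) auto
    then obtain I where I: "\<delta> I < d / 8"
      using d by (metis (mono_tags) eventually_sequentially order_refl order_tendstoD(2) divide_pos_pos zero_less_numeral)
    have "(\<lambda>n. s I (u n)) \<longlonglongrightarrow> 0"
      unfolding s_def by (intro tendsto_null_sum \<psi>_u)
    then obtain N where N: "\<And>n. n \<ge> N \<Longrightarrow> circle_norm (s I (u n)) < d / 2"
      using d unfolding lim_sequentially dist_circle_0 by (metis half_gt_zero)
    have "circle_norm (\<xi> (u n)) < d" if "n \<ge> N" for n
    proof -
      obtain J where J: "J \<ge> I" "circle_norm (s J (u n) - \<xi> (u n)) < d / 8"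
        using near[of "d / 8"] d by auto
      have "s J (u n) - s I (u n) = (\<Sum>i\<in>{I..<J}. \<psi> (\<kappa> i) (u n))"
        using sum_diff_nat_ivl[of 0 I J "\<lambda>i. \<psi> (\<kappa> i) (u n)"] J(1) by (simp add: s_def atLeast0LessThan)
      then have "circle_norm (s J (u n) - s I (u n)) \<le> (\<Sum>i\<in>{I..<J}. circle_norm (\<psi> (\<kappa> i) (u n)))"
        by (simp add: circle_norm_sum)
      also have "\<dots> \<le> (\<Sum>i\<in>{I..<J}. \<delta> i)" by (intro sum_mono \<kappa>_u)
      also have "\<dots> \<le> 2 * \<delta> I" by (rule \<delta>_sum)
      finally have "circle_norm (s J (u n) - s I (u n)) < d / 4" using I by simp
      moreover have "circle_norm (\<xi> (u n) - s J (u n)) < d / 8"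
        using J(2) by (simp add: dist_commute flip: dist_circle_def)
      ultimately show ?thesis
        using N[OF that] circle_norm_le_add_diff[of "\<xi> (u n)" "s J (u n)"]
          circle_norm_le_add_diff[of "s J (u n)" "s I (u n)"] d by linarith
    qed
    then show "\<exists>N. \<forall>n\<ge>N. circle_norm (\<xi> (u n)) < d" by blast
  qed
  with null \<xi> have "(\<lambda>n. \<xi> (v n)) \<longlonglongrightarrow> 0" by blast
  then obtain N where N: "\<And>n. n \<ge> N \<Longrightarrow> circle_norm (\<xi> (v n)) < e / 4"
    using e unfolding lim_sequentially dist_circle_0 by (metis divide_pos_pos zero_less_numeral)
  \<comment> \<open>At this point the diagonal term is at least \<open>e / 2\<close>, while all the others together, and then the
    passage to the cluster point, cost at most \<open>e / 8\<close> each.\<close>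
  let ?w = "v (p (\<kappa> N))"
  obtain J where J: "J \<ge> Suc N" "circle_norm (s J ?w - \<xi> ?w) < e / 8"
    using near[of "e / 8" "Suc N"] e by auto
  have "s J ?w = \<psi> (\<kappa> N) ?w + (\<Sum>i\<in>{..<J} - {N}. \<psi> (\<kappa> i) ?w)"
    unfolding s_def using J(1) by (intro sum.remove) auto
  then have "circle_norm (s J ?w - \<psi> (\<kappa> N) ?w) \<le> (\<Sum>i\<in>{..<J} - {N}. circle_norm (\<psi> (\<kappa> i) ?w))"
    by (simp add: circle_norm_sum)
  also have "\<dots> \<le> (\<Sum>i\<in>{..<J} - {N}. \<delta> i)" by (intro sum_mono off_diag) auto
  also have "\<dots> \<le> (\<Sum>i\<in>{0..<J}. \<delta> i)"
    using \<delta>_pos by (intro sum_mono2) (auto simp: less_imp_le)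
  also have "\<dots> \<le> e / 8" using \<delta>_sum[of 0 J] by (simp add: \<delta>_def)
  finally have "circle_norm (\<psi> (\<kappa> N) ?w - s J ?w) \<le> e / 8"
    by (simp add: dist_commute flip: dist_circle_def)
  then have "circle_norm (\<xi> ?w) \<ge> e / 4"
    using diag[of N] J(2) circle_norm_le_add_diff[of "\<psi> (\<kappa> N) ?w" "s J ?w"]
      circle_norm_le_add_diff[of "s J ?w" "\<xi> ?w"] by linarith
  moreover have "p (\<kappa> N) \<ge> N" using p[of "\<kappa> N"] \<kappa>_ge[of N] by simp
  ultimately show False using N by fastforce
qed


section \<open>Group topologies\<close>

lemma group_topology_0_sum_subset:
  assumes t: "group_topology t" and W: "openin t W" "0 \<in> W"
  obtains V where "openin t V" "0 \<in> V" "V \<subseteq> W" "\<And>x y. x \<in> V \<Longrightarrow> y \<in> V \<Longrightarrow> x + y \<in> W"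
proof -
  have "openin (prod_topology t t) {p. fst p + snd p \<in> W}"
    using t openin_continuous_map_preimage[of "prod_topology t t" t "\<lambda>(x, y). x + y" W] W(1)
    by (simp add: group_topology_def case_prod_unfold)
  moreover have "(0, 0) \<in> {p. fst p + snd p \<in> W}" using W(2) by simp
  ultimately have "\<exists>A B. openin t A \<and> openin t B \<and> 0 \<in> A \<and> 0 \<in> B \<and> A \<times> B \<subseteq> {p. fst p + snd p \<in> W}"
    unfolding openin_prod_topology_alt by (elim allE impE)
  then obtain A B where "openin t A" "openin t B" "0 \<in> A" "0 \<in> B" "A \<times> B \<subseteq> {p. fst p + snd p \<in> W}"
    by (elim exE conjE)
  then show ?thesis using W by (intro that[of "A \<inter> B \<inter> W"]) auto
qed

lemma group_topology_0_diff_subset: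
  assumes t: "group_topology t" and W: "openin t W" "0 \<in> W"
  obtains V where "openin t V" "0 \<in> V" "\<And>x y. x \<in> V \<Longrightarrow> y \<in> V \<Longrightarrow> x - y \<in> W"
proof -
  obtain V where V: "openin t V" "0 \<in> V" "\<And>x y. x \<in> V \<Longrightarrow> y \<in> V \<Longrightarrow> x + y \<in> W"
    using group_topology_0_sum_subset[OF assms] by metis
  have "openin t {x. - x \<in> V}"
    using t openin_continuous_map_preimage[of t t uminus V] V(1) by (simp add: group_topology_def)
  moreover have "x - y \<in> W" if "x \<in> V \<inter> {x. - x \<in> V}" "y \<in> V \<inter> {x. - x \<in> V}" for x y
    using V(3)[of x "- y"] that by simp
  ultimately show ?thesis using V by (intro that[of "V \<inter> {x. - x \<in> V}"]) auto
qed

lemma group_topology_pullback: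
  fixes \<phi> :: "'a::ab_group_add \<Rightarrow> circle"
  assumes "Modules.additive \<phi>"
  shows "group_topology (pullback_topology UNIV \<phi> euclidean)" (is "group_topology ?t")
proof -
  have \<phi>: "continuous_map ?t euclidean \<phi>"
    using continuous_map_pullback[OF continuous_map_id[of euclidean], of UNIV \<phi>] by simp
  have "continuous_map (prod_topology ?t ?t) euclidean (\<lambda>p. \<phi> (fst p) + \<phi> (snd p))"
  proof -
    have "continuous_map (prod_topology ?t ?t) (prod_topology euclidean euclidean) (\<lambda>p. (\<phi> (fst p), \<phi> (snd p)))"
      using continuous_map_compose[OF continuous_map_fst \<phi>] continuous_map_compose[OF continuous_map_snd \<phi>]
      by (intro continuous_map_pairedI) (simp_all add: o_def)
    moreover have "continuous_map (prod_topology euclidean euclidean) euclidean (\<lambda>p :: circle \<times> circle. fst p + snd p)"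
      using continuous_on_add[OF continuous_on_fst[OF continuous_on_id] continuous_on_snd[OF continuous_on_id]]
      by simp
    ultimately have "continuous_map (prod_topology ?t ?t) euclidean
        ((\<lambda>p. fst p + snd p) \<circ> (\<lambda>p. (\<phi> (fst p), \<phi> (snd p))))"
      by (rule continuous_map_compose)
    then show ?thesis by (simp add: o_def)
  qed
  then have "continuous_map (prod_topology ?t ?t) ?t (\<lambda>(x, y). x + y)"
    by (intro continuous_map_pullback')
      (auto simp: o_def case_prod_unfold Modules.additive.add[OF assms])
  moreover have "continuous_map ?t euclidean (\<lambda>x. - \<phi> x)"
  proof -
    have "continuous_on UNIV (uminus :: circle \<Rightarrow> circle)" by (intro continuous_intros)
    then show ?thesis using continuous_map_compose[OF \<phi>, of euclidean uminus] by (simp add: o_def)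
  qed
  then have "continuous_map ?t ?t uminus"
    by (intro continuous_map_pullback') (auto simp: o_def Modules.additive.minus[OF assms])
  ultimately show ?thesis
    by (simp add: group_topology_def topspace_pullback_topology)
qed

text \<open>
  The pullback topology is in general not Hausdorff, so the supremum of precompact topologies
  does not cover this case. Total boundedness holds because the group is covered by finitely many
  translates of a small set and, by compactness of the circle, by preimages of finitely many small
  balls; a representative of each nonempty cell of the common refinement serves as a translation.
\<close>

lemma precompact_sup_pullback:
  fixes \<phi> :: "'a::ab_group_add \<Rightarrow> circle"
  assumes t: "precompact_group_topology t" and \<phi>: "Modules.additive \<phi>"
  shows "precompact_group_topology
    (sup_topology (\<lambda>s. s = t \<or> s = pullback_topology UNIV \<phi> euclidean))"
    (is "precompact_group_topology (sup_topology ?P)")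
proof -
  have gt: "group_topology t" "Hausdorff_space t" "topspace t = UNIV"
    using t by (auto simp: precompact_group_topology_def group_topology_def)
  have base: "\<exists>A e. openin t A \<and> 0 \<in> A \<and> e > 0 \<and> {x \<in> A. circle_norm (\<phi> x) < e} \<subseteq> U"
    if "generate_topology_on {U. \<exists>s. ?P s \<and> openin s U} U" "0 \<in> U" for U
    using that
  proof (induction)
    case (Int a b)
    then obtain A e B d where "openin t A" "0 \<in> A" "e > 0" "{x \<in> A. circle_norm (\<phi> x) < e} \<subseteq> a"
      "openin t B" "0 \<in> B" "d > 0" "{x \<in> B. circle_norm (\<phi> x) < d} \<subseteq> b"
      by blast
    then show ?case by (intro exI[of _ "A \<inter> B"] exI[of _ "min e d"]) auto
  next
    case (UN K)
    then obtain k where "k \<in> K" "0 \<in> k" by blast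
    then show ?case using UN.IH[of k] by blast
  next
    case (Basis U)
    then consider "openin t U" | "openin (pullback_topology UNIV \<phi> euclidean) U" by auto
    then show ?case
    proof cases
      case 1
      then show ?thesis using Basis.prems by (intro exI[of _ U] exI[of _ 1]) auto
    next
      case 2
      then obtain B where B: "open B" "U = \<phi> -` B" by (auto simp: openin_pullback_topology)
      then have "0 \<in> B" using Basis.prems Modules.additive.zero[OF \<phi>] by simp
      then obtain e where "e > 0" "\<And>y. circle_norm y < e \<Longrightarrow> y \<in> B"
        using B(1) unfolding open_dist by (metis dist_circle_0)
      then show ?thesis
        using B(2) gt(3) openin_topspace[of t] by (intro exI[of _ UNIV] exI[of _ e]) auto
    qed
  qed simp
  have "\<exists>F. finite F \<and> {f + x | f x. f \<in> F \<and> x \<in> U} = UNIV" if U: "nhd_zero (sup_topology ?P) U" for U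
  proof -
    obtain W where W: "openin (sup_topology ?P) W" "0 \<in> W" "W \<subseteq> U" using U unfolding nhd_zero_def by blast
    then obtain A e where A: "openin t A" "0 \<in> A" and e: "e > 0"
        and AW: "{x \<in> A. circle_norm (\<phi> x) < e} \<subseteq> W"
      using base[of W] by (auto simp: sup_topology_def openin_topology_generated_by_iff)
    obtain V where V: "openin t V" "0 \<in> V" "\<And>x y. x \<in> V \<Longrightarrow> y \<in> V \<Longrightarrow> x - y \<in> A"
      using group_topology_0_diff_subset[OF gt(1) A] by metis
    then have "nhd_zero t V" unfolding nhd_zero_def by blast
    then obtain F where F: "finite F" "{f + x | f x. f \<in> F \<and> x \<in> V} = UNIV"
      using t unfolding precompact_group_topology_def by blast
    obtain C where C: "finite C" "UNIV \<subseteq> (\<Union>c\<in>C. ball (c::circle) (e / 2))"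
      using compact_UNIV_circle e unfolding compact_eq_totally_bounded by (metis half_gt_zero)
    define cell where "cell f c = {z. z - f \<in> V \<and> dist c (\<phi> z) < e / 2}" for f c
    define rep where "rep f c = (SOME z. z \<in> cell f c)" for f c
    let ?F = "(\<lambda>(f, c). rep f c) ` (F \<times> C)"
    have "z \<in> {f + x | f x. f \<in> ?F \<and> x \<in> U}" for z
    proof -
      have "z \<in> {f + x | f x. f \<in> F \<and> x \<in> V}" using F(2) by simp
      then obtain f where f: "f \<in> F" "z - f \<in> V" by auto
      have "\<phi> z \<in> (\<Union>c\<in>C. ball c (e / 2))" using C(2) by blast
      then obtain c where c: "c \<in> C" "dist c (\<phi> z) < e / 2" by auto
      have z: "z \<in> cell f c" using f c by (simp add: cell_def)
      then have r: "rep f c \<in> cell f c" unfolding rep_def by (rule someI)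
      have "z - rep f c \<in> A"
        using V(3)[of "z - f" "rep f c - f"] z r by (simp only: cell_def mem_Collect_eq diff_diff_eq2 diff_add_cancel)
      moreover have "dist (\<phi> z) (\<phi> (rep f c)) < e"
        by (rule dist_triangle_half_r[of c]) (use z r in \<open>auto simp: cell_def\<close>)
      then have "circle_norm (\<phi> (z - rep f c)) < e"
        by (simp only: dist_circle_def Modules.additive.diff[OF \<phi>])
      ultimately have "z - rep f c \<in> U" using AW W(3) by blast
      moreover have "rep f c \<in> ?F" using f(1) c(1) by (intro image_eqI[of _ _ "(f, c)"]) auto
      moreover have "z = rep f c + (z - rep f c)" by simp
      ultimately show ?thesis by (intro CollectI exI conjI)
    qed
    then have "{f + x | f x. f \<in> ?F \<and> x \<in> U} = UNIV" by (intro UNIV_eq_I[symmetric])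
    then show ?thesis using F(1) C(1) by (intro exI[of _ ?F] conjI finite_imageI finite_cartesian_product)
  qed
  moreover have "group_topology (sup_topology ?P)"
    using gt(1) group_topology_pullback[OF \<phi>] by (intro group_topology_sup[of ?P t]) auto
  moreover have "Hausdorff_space (sup_topology ?P)"
    using gt by (intro Hausdorff_sup[of ?P t]) auto
  ultimately show ?thesis unfolding precompact_group_topology_def by blast
qed

text \<open>
  A character that is null along \<open>u\<close> can be made continuous by a precompact refinement of
  \<open>finest_precompact u\<close> in which \<open>u\<close> is still null; by maximality, it was continuous already.
\<close>

lemma continuous_map_finest_precompact_iff:
  fixes u :: "nat \<Rightarrow> 'a::ab_group_add" and \<phi> :: "'a \<Rightarrow> circle"
  assumes u: "TB_sequence u" and \<phi>: "Modules.additive \<phi>"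
  shows "continuous_map (finest_precompact u) euclidean \<phi> \<longleftrightarrow> (\<lambda>n. \<phi> (u n)) \<longlonglongrightarrow> 0"
proof -
  let ?t = "finest_precompact u"
  have fin: "precompact_group_topology ?t" "limitin ?t u 0 sequentially"
    and finest: "\<forall>s. precompact_group_topology s \<and> limitin s u 0 sequentially \<longrightarrow> (\<forall>U. openin s U \<longrightarrow> openin ?t U)"
    using is_finest_finest_precompact[OF u] unfolding is_finest_def by simp_all
  have top: "topspace ?t = UNIV"
    using fin(1) by (simp add: precompact_group_topology_def group_topology_def)
  have "(\<lambda>n. \<phi> (u n)) \<longlonglongrightarrow> 0" if "continuous_map ?t euclidean \<phi>"
  proof -
    have "limitin euclidean (\<phi> \<circ> u) (\<phi> 0) sequentially"
      using that fin(2) by (rule continuous_map_limit)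
    then show ?thesis by (simp add: o_def Modules.additive.zero[OF \<phi>])
  qed
  moreover have "continuous_map ?t euclidean \<phi>" if null: "(\<lambda>n. \<phi> (u n)) \<longlonglongrightarrow> 0"
  proof -
    let ?p = "pullback_topology UNIV \<phi> euclidean"
    let ?s = "sup_topology (\<lambda>s. s = ?t \<or> s = ?p)"
    have "limitin ?p u 0 sequentially"
      unfolding limitin_def
    proof (intro conjI allI impI)
      show "0 \<in> topspace ?p" by (simp add: topspace_pullback_topology)
      fix U assume "openin ?p U \<and> 0 \<in> U"
      then obtain B where B: "open B" "U = \<phi> -` B" "0 \<in> B"
        by (auto simp: openin_pullback_topology Modules.additive.zero[OF \<phi>])
      then show "\<forall>\<^sub>F n in sequentially. u n \<in> U"
        using topological_tendstoD[OF null, of B] by simp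
    qed
    then have "limitin ?s u 0 sequentially"
      using fin(2) top by (intro limitin_sup[of _ ?t]) auto
    then have fine: "openin ?t U" if "openin ?s U" for U
      using finest[rule_format, OF conjI, OF precompact_sup_pullback[OF fin(1) \<phi>] _ that] by simp
    have "openin ?t (\<phi> -` B)" if "open B" for B
    proof (rule fine, rule openin_sup_topology[of _ ?p])
      show "openin ?p (\<phi> -` B)"
        unfolding openin_pullback_topology using that by (intro exI[of _ B]) simp
    qed simp
    then show ?thesis
      by (simp add: continuous_map_def top vimage_def)
  qed
  ultimately show ?thesis by blast
qed

text \<open>
  The polar of a neighbourhood is equicontinuous: if \<open>x\<close> and \<open>x + x\<close> lie where all its characters
  are bounded by \<open>b \<le> 1/4\<close>, then these characters are bounded by \<open>b / 2\<close> at \<open>x\<close>.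
\<close>

lemma uniform_limit_polar:
  assumes t: "group_topology t" and u: "limitin t u 0 sequentially" and V: "nhd_zero t V"
  shows "uniform_limit {\<phi>. Modules.additive \<phi> \<and> \<phi> ` V \<subseteq> circle_plus} (\<lambda>n \<phi>. \<phi> (u n)) (\<lambda>_. 0) sequentially"
    (is "uniform_limit ?S _ _ _")
proof (rule uniform_limitI)
  fix e :: real assume "e > 0"
  have small: "\<exists>W. openin t W \<and> 0 \<in> W \<and> (\<forall>\<phi>\<in>?S. \<forall>x\<in>W. circle_norm (\<phi> x) \<le> 1/4 * (1/2) ^ k)" for k
  proof (induction k)
    case 0
    obtain W where "openin t W" "0 \<in> W" "W \<subseteq> V" using V unfolding nhd_zero_def by blast
    then show ?case by (intro exI[of _ W]) (auto simp: image_subset_iff circle_plus_iff)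
  next
    case (Suc k)
    then obtain W where W: "openin t W" "0 \<in> W"
      "\<And>\<phi> x. \<phi> \<in> ?S \<Longrightarrow> x \<in> W \<Longrightarrow> circle_norm (\<phi> x) \<le> 1/4 * (1/2) ^ k" by blast
    obtain W' where W': "openin t W'" "0 \<in> W'" "W' \<subseteq> W" "\<And>x y. x \<in> W' \<Longrightarrow> y \<in> W' \<Longrightarrow> x + y \<in> W"
      using group_topology_0_sum_subset[OF t W(1,2)] by metis
    have "circle_norm (\<phi> x) \<le> 1/4 * (1/2) ^ Suc k" if "\<phi> \<in> ?S" "x \<in> W'" for \<phi> x
    proof -
      have "(1/2 :: real) ^ k \<le> 1" by (simp add: power_le_one)
      then have "circle_norm (\<phi> x) \<le> 1/4"
        using W(3)[OF that(1), of x] W'(3) that(2) by fastforce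
      moreover have "circle_norm (\<phi> x + \<phi> x) \<le> 1/4 * (1/2) ^ k"
        using W(3)[OF that(1) W'(4)[OF that(2,2)]] that(1) by (simp add: Modules.additive.add)
      ultimately show ?thesis by (simp add: circle_norm_double)
    qed
    then show ?case using W' by blast
  qed
  have "(\<lambda>k. 1/4 * (1/2 :: real) ^ k) \<longlonglongrightarrow> 0"
    by (intro tendsto_mult_right_zero LIMSEQ_realpow_zero) auto
  then obtain k where k: "1/4 * (1/2 :: real) ^ k < e"
    using \<open>e > 0\<close> by (metis (mono_tags, lifting) eventually_sequentially order_refl order_tendstoD(2))
  obtain W where W: "openin t W" "0 \<in> W" "\<forall>\<phi>\<in>?S. \<forall>x\<in>W. circle_norm (\<phi> x) \<le> 1/4 * (1/2) ^ k"
    using small by blast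
  have "\<forall>\<^sub>F n in sequentially. u n \<in> W" using u W by (simp add: limitin_def)
  then show "\<forall>\<^sub>F n in sequentially. \<forall>\<phi>\<in>?S. dist (\<phi> (u n)) 0 < e"
    by eventually_elim (use W(3) k in force)
qed

text \<open>
  A locally quasi-convex topology sees convergence through polars, and polars of
  neighbourhoods of \<open>0\<close> are uniformly null along \<open>u\<close>, hence along \<open>v\<close>.
\<close>

lemma limitin_locally_quasi_convex:
  fixes u v :: "nat \<Rightarrow> 'a::ab_group_add"
  assumes t: "group_topology t" and lqc: "locally_quasi_convex t" and u: "limitin t u 0 sequentially"
    and null: "\<And>\<xi> :: 'a \<Rightarrow> circle. Modules.additive \<xi> \<Longrightarrow> (\<lambda>n. \<xi> (u n)) \<longlonglongrightarrow> 0 \<Longrightarrow> (\<lambda>n. \<xi> (v n)) \<longlonglongrightarrow> 0"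
  shows "limitin t v 0 sequentially"
  unfolding limitin_def
proof (intro conjI allI impI)
  show "0 \<in> topspace t" using t by (simp add: group_topology_def)
  fix U assume "openin t U \<and> 0 \<in> U"
  then have "nhd_zero t U" unfolding nhd_zero_def by blast
  then obtain V where V: "nhd_zero t V" "quasi_convex t V" "V \<subseteq> U"
    using lqc unfolding locally_quasi_convex_def by blast
  let ?S = "{\<phi> :: 'a \<Rightarrow> circle. Modules.additive \<phi> \<and> \<phi> ` V \<subseteq> circle_plus}"
  have "uniform_limit ?S (\<lambda>n \<phi>. \<phi> (v n)) (\<lambda>_. 0) sequentially"
    by (rule uniform_limit_null_transfer[OF null _ uniform_limit_polar[OF t u V(1)]]) auto
  then have "\<forall>\<^sub>F n in sequentially. \<forall>\<phi>\<in>?S. circle_norm (\<phi> (v n)) < 1/4"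
    unfolding uniform_limit_iff dist_circle_0 by (meson divide_pos_pos zero_less_one zero_less_numeral)
  then show "\<forall>\<^sub>F n in sequentially. v n \<in> U"
  proof eventually_elim
    case (elim n)
    have "v n \<in> V"
    proof (rule ccontr)
      assume "v n \<notin> V"
      then obtain \<phi> where \<phi>: "continuous_character t \<phi>" "\<phi> ` V \<subseteq> circle_plus" "\<phi> (v n) \<notin> circle_plus"
        using V(2) unfolding quasi_convex_def by blast
      then have "\<phi> \<in> ?S" by (simp add: continuous_character_def Modules.additive_def)
      then show False using elim \<phi>(3) by (force simp: circle_plus_iff)
    qed
    then show ?case using V(3) by blast
  qed
qed

lemma finest_Hausdorff_finer:
  fixes u v :: "nat \<Rightarrow> 'a::ab_group_add"
  assumes u: "TB_sequence u" and v: "TB_sequence v"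
    and lqc: "locally_quasi_convex (finest_Hausdorff u)"
    and eq: "finest_precompact u = finest_precompact v"
    and U: "openin (finest_Hausdorff u) U"
  shows "openin (finest_Hausdorff v) U"
proof -
  have fu: "group_topology (finest_Hausdorff u)" "Hausdorff_space (finest_Hausdorff u)"
      "limitin (finest_Hausdorff u) u 0 sequentially"
    using is_finest_finest_Hausdorff[OF u] unfolding is_finest_def by blast+
  have "limitin (finest_Hausdorff u) v 0 sequentially"
  proof (rule limitin_locally_quasi_convex[OF fu(1) lqc fu(3)])
    fix \<xi> :: "'a \<Rightarrow> circle"
    assume "Modules.additive \<xi>" "(\<lambda>n. \<xi> (u n)) \<longlonglongrightarrow> 0"
    then show "(\<lambda>n. \<xi> (v n)) \<longlonglongrightarrow> 0"
      using continuous_map_finest_precompact_iff[OF u] continuous_map_finest_precompact_iff[OF v] eq by metis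
  qed
  then show ?thesis
    using is_finest_finest_Hausdorff[OF v] fu(1,2) U unfolding is_finest_def by blast
qed

theorem theorem3p11:
  fixes u v :: "nat \<Rightarrow> 'a::ab_group_add"
  assumes "infinite (UNIV :: 'a set)"
    and "TB_sequence u" and "TB_sequence v"
    and "locally_quasi_convex (finest_Hausdorff u)"
    and "locally_quasi_convex (finest_Hausdorff v)"
    and "finest_precompact u = finest_precompact v"
  shows "finest_Hausdorff u = finest_Hausdorff v"
  unfolding topology_eq
  using finest_Hausdorff_finer[OF assms(2,3,4,6)] finest_Hausdorff_finer[OF assms(3,2,5) assms(6)[symmetric]]
  by blast

end
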